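(* Any streaming algorithm for \textsc{Diameter} in the AL model that works correctly on a family of graphs containing all "Windmill-Perm" graphs $WP_N(\pi,\psi,\gamma)$ and uses one pass over the stream requires $\Omega(n\log n)$ bits of memory, where $n$ is the number of vertices.
   Context: Let $N$ be a power of $2$, $\pi$ a permutation of $\{1,\dots,N\}$, $\psi\in\{1,\dots,N\}$ and $\gamma\in\{1,\dots,\log N\}$; each index $i$ is written in binary with $\log N$ bits. The tree $WP_N(\pi,\psi,\gamma)$ on $7N+8$ vertices is built as follows. Take a path $t_1t_2\cdots t_8$. For each $i$ add vertices $u_{i,2},u_{i,3},u_{i,4},v_{i,1},v_{i,2},v_{i,3},v_{i,4}$ and set $u_{i,1} := t_1$. If $i=\psi$ add edges $u_{i,1}u_{i,2}, u_{i,2}u_{i,3}$, otherwise add edges $u_{i,1}u_{i,2},u_{i,1}u_{i,3}$. If the $\gamma$-th bit of $i$ is $1$ add edges $v_{i,1}v_{i,2},v_{i,2}v_{i,3}$, otherwise add edges $v_{i,1}v_{i,2},v_{i,1}v_{i,3}$. Add edges $u_{i,3}u_{i,4}$ and $v_{i,4}v_{i,1}$, and the edge $u_{i,4}v_{\pi(i),4}$. \textsc{Diameter}: compute $\max_{s,t} d(s,t)$. In the Adjacency List (AL) streaming model the graph arrives as a sequence of vertices in arbitrary fixed order, each with the full list of its incident edges. Memory is in bits. "Requires $\Omega(f)$ bits" means there is a constant $c_0>0$ such that every such one-pass algorithm uses at least $c_0 f$ bits on some $n$-vertex input from the family, for all sufficiently large $n$.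
   Formalization: The bound is stated for all sufficiently large n of the form 7N+8 with N a power of 2, since a family consisting only of Windmill-Perm graphs contains no n-vertex graph for any other n. *)

theory Defs
  imports Complex_Main "HOL-Library.Extended_Nat" "HOL-Combinatorics.Permutations"
begin

section \<open>Finite simple graphs, distance, diameter\<close>

type_synonym 'a ugraph = "'a set \<times> 'a set set"

abbreviation verts :: "'a ugraph \<Rightarrow> 'a set" where
  "verts G \<equiv> fst G"

abbreviation edges :: "'a ugraph \<Rightarrow> 'a set set" where
  "edges G \<equiv> snd G"

definition simple_graph :: "'a ugraph \<Rightarrow> bool" where
  "simple_graph G \<longleftrightarrow> finite (verts G) \<and> (\<forall>e\<in>edges G. e \<subseteq> verts G \<and> card e = 2)"

definition walk_betw :: "'a ugraph \<Rightarrow> 'a \<Rightarrow> 'a list \<Rightarrow> 'a \<Rightarrow> bool" where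
  "walk_betw G s p t \<longleftrightarrow>
     p \<noteq> [] \<and> hd p = s \<and> last p = t \<and> set p \<subseteq> verts G \<and>
     (\<forall>i. Suc i < length p \<longrightarrow> {p ! i, p ! Suc i} \<in> edges G)"

text \<open>The distance is \<open>\<infinity>\<close> if there is no walk, so that the diameter of a
  disconnected graph is \<open>\<infinity>\<close>.\<close>

definition graph_dist :: "'a ugraph \<Rightarrow> 'a \<Rightarrow> 'a \<Rightarrow> enat" where
  "graph_dist G s t = (INF p\<in>{p. walk_betw G s p t}. enat (length p - 1))"

definition diameter :: "'a ugraph \<Rightarrow> enat" where
  "diameter G = (SUP s\<in>verts G. SUP t\<in>verts G. graph_dist G s t)"

definition map_graph :: "('a \<Rightarrow> 'b) \<Rightarrow> 'a ugraph \<Rightarrow> 'b ugraph" where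
  "map_graph f G = (f ` verts G, (`) f ` edges G)"


section \<open>One-pass algorithms in the Adjacency List model\<close>

text \<open>A stream item is a vertex together with the list of its incident edges.
  The order of the vertices and the order inside each list are arbitrary.\<close>

type_synonym 'a al_item = "'a \<times> 'a set list"

definition al_stream :: "'a ugraph \<Rightarrow> 'a al_item list \<Rightarrow> bool" where
  "al_stream G xs \<longleftrightarrow>
     distinct (map fst xs) \<and> set (map fst xs) = verts G \<and>
     (\<forall>(v, es)\<in>set xs. distinct es \<and> set es = {e \<in> edges G. v \<in> e})"

text \<open>The memory content between two items is a bit string. No computability or
  working-space restriction is put on the transition and output functions, and only the memory
  carried from one item to the next is charged, so a lower bound on \<open>memory_used\<close> bounds from
  below the memory of any concrete implementation.\<close>

record 'a one_pass_alg =
  init :: "bool list"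
  step :: "bool list \<Rightarrow> 'a al_item \<Rightarrow> bool list"
  out :: "bool list \<Rightarrow> enat"

definition run :: "'a one_pass_alg \<Rightarrow> 'a al_item list \<Rightarrow> bool list" where
  "run A xs = foldl (step A) (init A) xs"

definition memory_used :: "'a one_pass_alg \<Rightarrow> 'a al_item list \<Rightarrow> nat" where
  "memory_used A xs = Max ((\<lambda>m. length (run A (take m xs))) ` {..length xs})"

text \<open>An algorithm may know the number \<open>n\<close> of vertices for free: \<open>A n\<close> is what is executed
  on \<open>n\<close>-vertex graphs. An algorithm not knowing \<open>n\<close> is the case of a constant \<open>A\<close>.\<close>

definition solves_diameter_on ::
    "(nat \<Rightarrow> 'a one_pass_alg) \<Rightarrow> 'a ugraph set \<Rightarrow> bool" where
  "solves_diameter_on A F \<longleftrightarrow>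
     (\<forall>G\<in>F. \<forall>xs. al_stream G xs \<longrightarrow>
        out (A (card (verts G))) (run (A (card (verts G))) xs) = diameter G)"


section \<open>Windmill-Perm graphs\<close>

datatype wp_vertex = T nat | U nat nat | V nat nat

text \<open>All the vertices \<open>u i 1\<close> are identified with \<open>T 1\<close>.\<close>

definition u :: "nat \<Rightarrow> nat \<Rightarrow> wp_vertex" where
  "u i j = (if j = 1 then T 1 else U i j)"

definition wp_verts :: "nat \<Rightarrow> wp_vertex set" where
  "wp_verts N = T ` {1..8} \<union> (\<Union>i\<in>{1..N}. U i ` {2..4}) \<union> (\<Union>i\<in>{1..N}. V i ` {1..4})"

text \<open>For \<open>N = 2 ^ k\<close> the \<open>k\<close>-bit representation of \<open>i \<in> {1..N}\<close> consists of its \<open>k\<close> low-order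
  bits (so \<open>N\<close> is written as \<open>0\<dots>0\<close>), the first bit being the least significant one. Counting
  from the other end amounts to replacing \<open>\<gamma>\<close> by \<open>k + 1 - \<gamma>\<close>; writing \<open>i - 1\<close> instead of \<open>i\<close>
  amounts to renaming the indices of the \<open>V\<close>-vertices cyclically, in \<open>\<pi>\<close> as well. Neither
  changes the class of graphs below.\<close>

definition wp_edges :: "nat \<Rightarrow> (nat \<Rightarrow> nat) \<Rightarrow> nat \<Rightarrow> nat \<Rightarrow> wp_vertex set set" where
  "wp_edges N \<pi> \<psi> \<gamma> =
     {{T j, T (j + 1)} | j. j \<in> {1..7}} \<union>
     (\<Union>i\<in>{1..N}.
        (if i = \<psi> then {{u i 1, u i 2}, {u i 2, u i 3}}
                  else {{u i 1, u i 2}, {u i 1, u i 3}}) \<union>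
        (if bit i (\<gamma> - 1) then {{V i 1, V i 2}, {V i 2, V i 3}}
                         else {{V i 1, V i 2}, {V i 1, V i 3}}) \<union>
        {{u i 3, u i 4}, {V i 4, V i 1}, {u i 4, V (\<pi> i) 4}})"

definition wp_graph :: "nat \<Rightarrow> (nat \<Rightarrow> nat) \<Rightarrow> nat \<Rightarrow> nat \<Rightarrow> wp_vertex ugraph" where
  "wp_graph N \<pi> \<psi> \<gamma> = (wp_verts N, wp_edges N \<pi> \<psi> \<gamma>)"

text \<open>The vertices of the graphs in a family are natural numbers, so the named vertices have to
  be numbered. The numbering may be any injective one, but for each \<open>N\<close> it has to be the same
  for all \<open>\<pi>\<close>, \<open>\<psi>\<close>, \<open>\<gamma>\<close>: otherwise the vertex numbers could give away the diameter. A family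
  that is closed under isomorphism and contains copies of all these graphs qualifies.\<close>

definition contains_all_wp :: "nat ugraph set \<Rightarrow> bool" where
  "contains_all_wp F \<longleftrightarrow>
     (\<forall>k. \<exists>lab. inj_on lab (wp_verts (2 ^ k)) \<and>
        (\<forall>\<pi> \<psi> \<gamma>. \<pi> permutes {1..2 ^ k} \<and> \<psi> \<in> {1..2 ^ k} \<and> \<gamma> \<in> {1..k} \<longrightarrow>
           map_graph lab (wp_graph (2 ^ k) \<pi> \<psi> \<gamma>) \<in> F))"

end

theory Submission
  imports Defs
begin

text \<open>Call the vertices \<open>U i 4\<close> and \<open>V i 4\<close> portals. The adjacency lists of the portals depend only
  on \<open>\<pi>\<close>, and all the other lists only on \<open>\<psi>\<close> and \<open>\<gamma>\<close>. The diameter is \<open>14\<close> if bit \<open>\<gamma>\<close> of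
  \<open>\<pi> \<psi>\<close> is set, and at most \<open>13\<close> otherwise: the only candidate for a pair at distance \<open>14\<close> is
  \<open>T 8\<close> and the end of the blade of \<open>\<psi>\<close>. So if the portals come first, the memory content after them must
  determine every bit of every \<open>\<pi> \<psi>\<close>, that is, the permutation; with \<open>N!\<close> different contents
  some content has at least about \<open>log N!\<close> bits.\<close>

section \<open>Walks and distances\<close>

lemma walk_betw_iff_successively:
  "walk_betw G s p t \<longleftrightarrow> p \<noteq> [] \<and> hd p = s \<and> last p = t \<and> set p \<subseteq> verts G \<and>
     successively (\<lambda>x y. {x, y} \<in> edges G) p"
  by (auto simp: walk_betw_def successively_conv_nth)

definition walk_within :: "'a ugraph \<Rightarrow> nat \<Rightarrow> 'a \<Rightarrow> 'a \<Rightarrow> bool" where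
  "walk_within G d s t \<longleftrightarrow> (\<exists>p. walk_betw G s p t \<and> length p \<le> Suc d)"

lemma walk_within_refl: "s \<in> verts G \<Longrightarrow> walk_within G 0 s s"
  unfolding walk_within_def by (rule exI[of _ "[s]"]) (simp add: walk_betw_def)

lemma walk_within_mono: "walk_within G d s t \<Longrightarrow> d \<le> d' \<Longrightarrow> walk_within G d' s t"
  unfolding walk_within_def by (meson Suc_le_mono le_trans)

lemma walk_within_sym: "walk_within G d s t \<Longrightarrow> walk_within G d t s"
  unfolding walk_within_def walk_betw_iff_successively
proof (elim exE conjE)
  fix p assume "p \<noteq> []" "hd p = s" "last p = t" "set p \<subseteq> verts G"
    "successively (\<lambda>x y. {x, y} \<in> edges G) p" "length p \<le> Suc d"
  then show "\<exists>p. (p \<noteq> [] \<and> hd p = t \<and> last p = s \<and> set p \<subseteq> verts G \<and>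
      successively (\<lambda>x y. {x, y} \<in> edges G) p) \<and> length p \<le> Suc d"
    by (intro exI[of _ "rev p"]) (simp add: hd_rev last_rev insert_commute)
qed

lemma walk_within_trans:
  assumes "walk_within G a s t" and "walk_within G b t w"
  shows "walk_within G (a + b) s w"
proof -
  from assms obtain p q where pq: "walk_betw G s p t" "length p \<le> Suc a"
    "walk_betw G t q w" "length q \<le> Suc b"
    unfolding walk_within_def by blast
  \<comment> \<open>The walks share the vertex \<open>t\<close>, so only the tail of
    \<open>q\<close> is appended; this is why the vertex counts \<open>Suc a\<close> and
    \<open>Suc b\<close> combine to \<open>Suc (a + b)\<close>.\<close>
  from pq(3) obtain r where r: "q = t # r"
    by (cases q) (auto simp: walk_betw_def)
  have "walk_betw G s (p @ r) w"
    using pq(1,3) unfolding r walk_betw_iff_successively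
    by (cases r) (auto simp: successively_append_iff)
  moreover have "length (p @ r) \<le> Suc (a + b)" using pq r by simp
  ultimately show ?thesis unfolding walk_within_def by blast
qed

lemma walk_within_step:
  assumes "walk_within G d s x" "{x, y} \<in> edges G" "x \<in> verts G" "y \<in> verts G"
  shows "walk_within G (Suc d) s y"
proof -
  have "walk_within G 1 x y"
    unfolding walk_within_def walk_betw_iff_successively
    by (rule exI[of _ "[x, y]"]) (use assms in auto)
  from walk_within_trans[OF assms(1) this] show ?thesis by simp
qed

lemma graph_dist_le_if_walk_within: "walk_within G d s t \<Longrightarrow> graph_dist G s t \<le> enat d"
  unfolding walk_within_def graph_dist_def
  by (elim exE conjE, rule INF_lower2) auto

section \<open>Invariance of the diameter under relabelling\<close>

lemma walk_betw_map_graph: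
  "walk_betw G s p t \<Longrightarrow> walk_betw (map_graph f G) (f s) (map f p) (f t)"
  unfolding walk_betw_def map_graph_def
  by (auto simp: hd_map last_map) (metis (no_types, lifting) Suc_lessD image_empty image_eqI image_insert)

lemma graph_dist_map_graph_le: "graph_dist (map_graph f G) (f s) (f t) \<le> graph_dist G s t"
  unfolding graph_dist_def
proof (rule INF_greatest)
  fix p assume "p \<in> {p. walk_betw G s p t}"
  then show "(INF p\<in>{p. walk_betw (map_graph f G) (f s) p (f t)}. enat (length p - 1))
      \<le> enat (length p - 1)"
    by (intro INF_lower2[of "map f p"]) (auto intro: walk_betw_map_graph)
qed

text \<open>Any vertex map, injective or not, sends walks to walks of the same length, so it cannot
  increase distances. Applying this to a bijection and to its inverse will give equality.\<close>

lemma diameter_map_graph_le: "diameter (map_graph f G) \<le> diameter G"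
proof -
  have "graph_dist (map_graph f G) (f s) (f t) \<le> diameter G"
    if "s \<in> verts G" "t \<in> verts G" for s t
    using graph_dist_map_graph_le[of f G s t] that unfolding diameter_def
    by (meson SUP_upper2 order_trans)
  then show ?thesis
    unfolding diameter_def[of "map_graph f G"] by (auto simp: map_graph_def intro!: SUP_least)
qed

lemma map_graph_inv_into:
  assumes "inj_on f (verts G)" and "\<Union> (edges G) \<subseteq> verts G"
  shows "map_graph (inv_into (verts G) f) (map_graph f G) = G"
proof -
  have "inv_into (verts G) f ` f ` e = e" if "e \<in> edges G" for e
    using assms that by (intro inv_into_image_cancel) auto
  then have "(`) (inv_into (verts G) f) ` (`) f ` edges G = edges G"
    by (force simp: image_image)
  then show ?thesis
    using assms(1) by (simp add: map_graph_def inv_into_image_cancel)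
qed

lemma diameter_map_graph:
  assumes "inj_on f (verts G)" and "\<Union> (edges G) \<subseteq> verts G"
  shows "diameter (map_graph f G) = diameter G"
  using diameter_map_graph_le[of f G]
    diameter_map_graph_le[of "inv_into (verts G) f" "map_graph f G"]
  by (simp add: map_graph_inv_into[OF assms])

text \<open>The potential \<open>f\<close> rises by at most 1 along each edge, so a walk on which it
  climbs by \<open>d\<close> has at least \<open>d\<close> edges. If there is no walk at all, the
  infimum is infinite.\<close>

lemma lipschitz_le_graph_dist:
  fixes f :: "'a \<Rightarrow> int"
  assumes "\<And>x y. {x, y} \<in> edges G \<Longrightarrow> f y \<le> f x + 1" and "f s + int d \<le> f t"
  shows "enat d \<le> graph_dist G s t"
proof -
  have lip: "f (last p) \<le> f (hd p) + int (length p - 1)"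
    if "p \<noteq> []" "successively (\<lambda>x y. {x, y} \<in> edges G) p" for p
    using that
  proof (induction p rule: list_nonempty_induct)
    case (cons x p)
    then show ?case
      using assms(1)[of x "hd p"] by (cases p) auto
  qed auto
  have "d \<le> length p - 1" if "walk_betw G s p t" for p
    using lip[of p] that assms(2) unfolding walk_betw_iff_successively by auto
  then show ?thesis unfolding graph_dist_def by (auto intro!: INF_greatest)
qed

section \<open>The diameter of Windmill-Perm graphs\<close>

lemma finite_wp_verts: "finite (wp_verts N)"
  by (simp add: wp_verts_def)

lemma T_in_wp_verts: "T j \<in> wp_verts N \<longleftrightarrow> j \<in> {1..8}"
  by (auto simp: wp_verts_def)

lemma U_in_wp_verts: "U i j \<in> wp_verts N \<longleftrightarrow> i \<in> {1..N} \<and> j \<in> {2..4}"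
  by (auto simp: wp_verts_def image_iff)

lemma V_in_wp_verts: "V i j \<in> wp_verts N \<longleftrightarrow> i \<in> {1..N} \<and> j \<in> {1..4}"
  by (auto simp: wp_verts_def image_iff)

lemmas in_wp_verts = T_in_wp_verts U_in_wp_verts V_in_wp_verts

lemma card_wp_verts: "card (wp_verts N) = 7 * N + 8"
proof -
  have U: "(\<Union>i\<in>{1..N}. U i ` {2..4}) = (\<lambda>(i, j). U i j) ` ({1..N} \<times> {2..4})"
    and V: "(\<Union>i\<in>{1..N}. V i ` {1..4}) = (\<lambda>(i, j). V i j) ` ({1..N} \<times> {1..4})"
    by auto
  have "card (T ` {1..8}) = 8"
    "card ((\<lambda>(i, j). U i j) ` ({1..N} \<times> {2..4})) = 3 * N"
    "card ((\<lambda>(i, j). V i j) ` ({1..N} \<times> {1..4})) = 4 * N"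
    by (subst card_image; auto simp: inj_on_def)+
  then show ?thesis
    unfolding wp_verts_def U V
    by (subst card_Un_disjoint; (subst card_Un_disjoint)?; auto)
qed

text \<open>The branches of each \<open>if\<close> in \<open>wp_edges\<close> share one edge, so the
  condition is moved to the other edge. The groups now separate the parameters: \<psi> occurs only
  in the second, \<gamma> only in the third and \<pi> only in the last. The splitting of the stream
  rests on this.\<close>

lemma mem_wp_edges_iff:
  "e \<in> wp_edges N \<pi> \<psi> \<gamma> \<longleftrightarrow> (\<exists>j\<in>{1..7}. e = {T j, T (j + 1)}) \<or>
    (\<exists>i\<in>{1..N}.
       e \<in> {{T 1, U i 2}, if i = \<psi> then {U i 2, U i 3} else {T 1, U i 3}} \<or>
       e \<in> {{V i 1, V i 2}, if bit i (\<gamma> - 1) then {V i 2, V i 3} else {V i 1, V i 3}} \<or>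
       e \<in> {{U i 3, U i 4}, {V i 4, V i 1}, {U i 4, V (\<pi> i) 4}})"
proof -
  have if_insert: "(if c then {a, b} else {a, d}) = {a, if c then b else d}"
    for c and a b d :: "wp_vertex set"
    by simp
  have u: "u i 1 = T 1" "u i 2 = U i 2" "u i 3 = U i 3" "u i 4 = U i 4" for i
    by (simp_all add: u_def)
  show ?thesis
    by (simp only: wp_edges_def u if_insert Un_iff UN_iff mem_Collect_eq Bex_def conj_commute disj_assoc)
qed

lemma wp_edgesI:
  shows wp_edgesI_path: "j \<in> {1..7} \<Longrightarrow> {T j, T (j + 1)} \<in> wp_edges N \<pi> \<psi> \<gamma>"
    and wp_edgesI_upper: "i \<in> {1..N} \<Longrightarrow>
      e \<in> {{T 1, U i 2}, if i = \<psi> then {U i 2, U i 3} else {T 1, U i 3}} \<Longrightarrow>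
      e \<in> wp_edges N \<pi> \<psi> \<gamma>"
    and wp_edgesI_lower: "i \<in> {1..N} \<Longrightarrow>
      e \<in> {{V i 1, V i 2}, if bit i (\<gamma> - 1) then {V i 2, V i 3} else {V i 1, V i 3}} \<Longrightarrow>
      e \<in> wp_edges N \<pi> \<psi> \<gamma>"
    and wp_edgesI_portal: "i \<in> {1..N} \<Longrightarrow>
      e \<in> {{U i 3, U i 4}, {V i 4, V i 1}, {U i 4, V (\<pi> i) 4}} \<Longrightarrow>
      e \<in> wp_edges N \<pi> \<psi> \<gamma>"
  unfolding mem_wp_edges_iff
  by ((rule disjI1, erule bexI[rotated], rule refl),
    (rule disjI2, erule bexI[rotated], erule disjI1),
    (rule disjI2, erule bexI[rotated], rule disjI2, erule disjI1),
    (rule disjI2, erule bexI[rotated], rule disjI2, erule disjI2))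

lemma wp_edgesE:
  assumes "e \<in> wp_edges N \<pi> \<psi> \<gamma>"
  obtains (path) j where "j \<in> {1..7}" "e = {T j, T (j + 1)}"
  | (upper) i where "i \<in> {1..N}"
      "e \<in> {{T 1, U i 2}, if i = \<psi> then {U i 2, U i 3} else {T 1, U i 3}}"
  | (lower) i where "i \<in> {1..N}"
      "e \<in> {{V i 1, V i 2}, if bit i (\<gamma> - 1) then {V i 2, V i 3} else {V i 1, V i 3}}"
  | (portal) i where "i \<in> {1..N}" "e \<in> {{U i 3, U i 4}, {V i 4, V i 1}, {U i 4, V (\<pi> i) 4}}"
  using assms unfolding mem_wp_edges_iff
  by (elim disjE bexE) (rule that; assumption)+

lemma Union_wp_edges_subset:
  assumes "\<pi> permutes {1..N}"
  shows "\<Union> (wp_edges N \<pi> \<psi> \<gamma>) \<subseteq> wp_verts N"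
proof (rule Union_least)
  fix e assume "e \<in> wp_edges N \<pi> \<psi> \<gamma>"
  then show "e \<subseteq> wp_verts N"
  proof (cases rule: wp_edgesE)
    case (portal i)
    moreover have "\<pi> i \<in> {1..N}" using permutes_in_image[OF assms] portal(1) by blast
    ultimately show ?thesis by (auto simp: in_wp_verts)
  qed (auto simp: in_wp_verts split: if_splits)
qed

section \<open>Bounds on the diameter: at least 14 or at most 13\<close>

lemma diameter_wp_ge:
  assumes \<pi>: "\<pi> permutes {1..N}" and \<psi>: "\<psi> \<in> {1..N}" and bit: "bit (\<pi> \<psi>) (\<gamma> - 1)"
  shows "14 \<le> diameter (wp_graph N \<pi> \<psi> \<gamma>)"
proof -
  text \<open>Signed distance from \<open>T 1\<close> along the path from \<open>T 8\<close> into the blade of \<open>\<psi>\<close>; the other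
    blades hang off \<open>T 1\<close>, so the constant \<open>0\<close> does there.\<close>
  define f where "f = (\<lambda>x. case x of T j \<Rightarrow> 1 - int j
    | U i j \<Rightarrow> if i = \<psi> then int j - 1 else 0
    | V i j \<Rightarrow> if i = \<pi> \<psi> then if j = 4 then 4 else 4 + int j else 0)"
  \<comment> \<open>Ensures that the edge from \<open>U i 4\<close> to \<open>V (\<pi> i) 4\<close>
    never joins the blade of \<psi> to another blade.\<close>
  have inj: "\<pi> i = \<pi> \<psi> \<longleftrightarrow> i = \<psi>" for i
    using permutes_inj[OF \<pi>] by (auto dest: injD)
  have "\<forall>x\<in>e. \<forall>y\<in>e. f y \<le> f x + 1" if "e \<in> wp_edges N \<pi> \<psi> \<gamma>" for e
    using that by (cases rule: wp_edgesE) (use bit in \<open>auto simp: f_def inj split: if_splits\<close>)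
  then have "f y \<le> f x + 1" if "{x, y} \<in> edges (wp_graph N \<pi> \<psi> \<gamma>)" for x y
    using that by (simp add: wp_graph_def)
  \<comment> \<open>The potential runs from -7 at \<open>T 8\<close> to 7 at
    \<open>V (\<pi> \<psi>) 3\<close>.\<close>
  moreover have "f (T 8) + int 14 \<le> f (V (\<pi> \<psi>) 3)"
    by (simp add: f_def)
  ultimately have "enat 14 \<le> graph_dist (wp_graph N \<pi> \<psi> \<gamma>) (T 8) (V (\<pi> \<psi>) 3)"
    by (rule lipschitz_le_graph_dist)
  also have "\<dots> \<le> diameter (wp_graph N \<pi> \<psi> \<gamma>)"
    unfolding diameter_def using permutes_in_image[OF \<pi>, of \<psi>] \<psi>
    by (intro SUP_upper2[of "T 8"] SUP_upper) (auto simp: wp_graph_def in_wp_verts)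
  finally show ?thesis by (simp add: numeral_eq_enat)
qed

text \<open>The direct route \<open>T 1\<close>, \<open>U i 3\<close>, \<open>U i 4\<close>,
  \<open>V (\<pi> i) 4\<close>, \<open>V (\<pi> i) 1\<close>, \<open>V (\<pi> i) 3\<close> has 5
  edges. A detour through \<open>U i 2\<close> (if \<open>i = \<psi>\<close>) or through
  \<open>V (\<pi> i) 2\<close> (if the bit is set) costs one more edge each, and the assumption
  \<open>bit\<close> rules out having both.\<close>

lemma walk_within_T1_blade:
  assumes \<pi>: "\<pi> permutes {1..N}" and bit: "\<not> bit (\<pi> \<psi>) (\<gamma> - 1)" and i: "i \<in> {1..N}"
    and v: "v \<in> U i ` {2..4} \<union> V (\<pi> i) ` {1..4}"
  shows "walk_within (wp_graph N \<pi> \<psi> \<gamma>) 6 (T 1) v"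
proof -
  let ?G = "wp_graph N \<pi> \<psi> \<gamma>"
  \<comment> \<open>The extra cost of the detour through \<open>U i 2\<close>.\<close>
  let ?d = "if i = \<psi> then 1 else 0"
  have \<pi>i: "\<pi> i \<in> {1..N}" using permutes_in_image[OF \<pi>] i by blast
  have W: "x \<in> verts ?G \<longleftrightarrow> x \<in> wp_verts N" for x by (simp add: wp_graph_def)
  have U: "{T 1, U i 2} \<in> edges ?G" "i = \<psi> \<Longrightarrow> {U i 2, U i 3} \<in> edges ?G"
    "i \<noteq> \<psi> \<Longrightarrow> {T 1, U i 3} \<in> edges ?G"
    unfolding wp_graph_def snd_conv by (rule wp_edgesI_upper[OF i], simp)+
  have UV: "{U i 3, U i 4} \<in> edges ?G" "{U i 4, V (\<pi> i) 4} \<in> edges ?G"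
    unfolding wp_graph_def snd_conv by (rule wp_edgesI_portal[OF i], simp)+
  have V: "{V (\<pi> i) 4, V (\<pi> i) 1} \<in> edges ?G"
    unfolding wp_graph_def snd_conv by (rule wp_edgesI_portal[OF \<pi>i], simp)
  have V': "{V (\<pi> i) 1, V (\<pi> i) 2} \<in> edges ?G"
    "bit (\<pi> i) (\<gamma> - 1) \<Longrightarrow> {V (\<pi> i) 2, V (\<pi> i) 3} \<in> edges ?G"
    "\<not> bit (\<pi> i) (\<gamma> - 1) \<Longrightarrow> {V (\<pi> i) 1, V (\<pi> i) 3} \<in> edges ?G"
    unfolding wp_graph_def snd_conv by (rule wp_edgesI_lower[OF \<pi>i], simp)+
  have t1: "walk_within ?G 0 (T 1) (T 1)"
    by (rule walk_within_refl) (simp add: W in_wp_verts)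
  have u2: "walk_within ?G 1 (T 1) (U i 2)"
    using walk_within_step[OF t1 U(1)] i by (simp add: W in_wp_verts)
  have u3: "walk_within ?G (1 + ?d) (T 1) (U i 3)"
    using walk_within_step[OF t1 U(3)] walk_within_step[OF u2 U(2)] i
    by (cases "i = \<psi>") (auto simp: W in_wp_verts)
  have u4: "walk_within ?G (2 + ?d) (T 1) (U i 4)"
    using walk_within_step[OF u3 UV(1)] i by (simp add: W in_wp_verts)
  have v4: "walk_within ?G (3 + ?d) (T 1) (V (\<pi> i) 4)"
    using walk_within_step[OF u4 UV(2)] i \<pi>i by (simp add: W in_wp_verts eval_nat_numeral)
  have v1: "walk_within ?G (4 + ?d) (T 1) (V (\<pi> i) 1)"
    using walk_within_step[OF v4 V] \<pi>i by (simp add: W in_wp_verts eval_nat_numeral)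
  have v2: "walk_within ?G (5 + ?d) (T 1) (V (\<pi> i) 2)"
    using walk_within_step[OF v1 V'(1)] \<pi>i by (simp add: W in_wp_verts eval_nat_numeral)
  have v3: "walk_within ?G 6 (T 1) (V (\<pi> i) 3)"
  proof (cases "bit (\<pi> i) (\<gamma> - 1)")
    case True
    with bit have "i \<noteq> \<psi>" by auto
    then show ?thesis
      using walk_within_step[OF v2 V'(2)[OF True]] \<pi>i by (simp add: W in_wp_verts)
  next
    case False
    then have "walk_within ?G (Suc (4 + ?d)) (T 1) (V (\<pi> i) 3)"
      using walk_within_step[OF v1 V'(3)[OF False]] \<pi>i by (simp add: W in_wp_verts)
    then show ?thesis by (rule walk_within_mono) simp
  qed
  have "v \<in> {U i 2, U i 3, U i 4, V (\<pi> i) 1, V (\<pi> i) 2, V (\<pi> i) 3, V (\<pi> i) 4}"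
    using v by (auto simp: atLeastAtMost_iff le_Suc_eq eval_nat_numeral)
  then show ?thesis
    using u2 u3 u4 v1 v2 v3 v4 by (auto elim!: walk_within_mono)
qed

lemma walk_within_T1_T:
  assumes "j \<in> {1..8}"
  shows "walk_within (wp_graph N \<pi> \<psi> \<gamma>) (j - 1) (T 1) (T j)"
proof -
  have "j \<ge> 1" "j \<le> 8" using assms by auto
  then show ?thesis
  proof (induction j rule: dec_induct)
    case base
    show ?case by (simp add: walk_within_refl wp_graph_def in_wp_verts)
  next
    case (step j)
    have "walk_within (wp_graph N \<pi> \<psi> \<gamma>) (Suc (j - 1)) (T 1) (T (Suc j))"
      using step by (intro walk_within_step[of _ _ _ "T j"])
        (auto simp: wp_graph_def in_wp_verts wp_edges_def)
    with step show ?case by simp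
  qed
qed

text \<open>Every pair is routed through \<open>T 1\<close>, from which \<open>T 8\<close> is within
  7 and all other vertices are within 6; two distinct vertices thus cost at most 6 + 7.\<close>

lemma diameter_wp_le:
  assumes \<pi>: "\<pi> permutes {1..N}" and bit: "\<not> bit (\<pi> \<psi>) (\<gamma> - 1)"
  shows "diameter (wp_graph N \<pi> \<psi> \<gamma>) \<le> 13"
proof -
  let ?G = "wp_graph N \<pi> \<psi> \<gamma>"
  have blade: "walk_within ?G 6 (T 1) v" if "v \<in> wp_verts N" "v \<noteq> T 8" for v
  proof (cases v)
    case (T j)
    with that have "j \<in> {1..8}" "j - 1 \<le> 6" by (auto simp: in_wp_verts)
    with T show ?thesis using walk_within_mono[OF walk_within_T1_T] by metis
  next
    case (U i j)
    with that show ?thesis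
      by (intro walk_within_T1_blade[OF assms, of i]) (auto simp: in_wp_verts)
  next
    case (V l j)
    \<comment> \<open>Surjectivity of \<pi> puts each \<open>V l j\<close> into some blade.\<close>
    with that have "l \<in> \<pi> ` {1..N}" and j: "j \<in> {1..4}"
      unfolding V permutes_image[OF \<pi>] V_in_wp_verts by simp_all
    then obtain i where "i \<in> {1..N}" "l = \<pi> i" by blast
    with j V show ?thesis
      by (intro walk_within_T1_blade[OF assms, of i]) (auto simp: in_wp_verts)
  qed
  have T8: "walk_within ?G 7 (T 1) (T 8)"
    using walk_within_T1_T[of 8] by simp
  have "walk_within ?G 13 s t" if s: "s \<in> wp_verts N" and t: "t \<in> wp_verts N" for s t
  proof (cases "s = T 8")
    case True
    show ?thesis
    \<comment> \<open>The pair \<open>T 8\<close>, \<open>T 8\<close> is treated apart, since the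
      route through \<open>T 1\<close> would have length 14.\<close>
    proof (cases "t = T 8")
      case True
      with \<open>s = T 8\<close> s show ?thesis
        by (auto simp: wp_graph_def intro!: walk_within_mono[OF walk_within_refl])
    next
      case False
      with True t show ?thesis
        using walk_within_trans[OF walk_within_sym[OF T8] blade[of t]] by simp
    qed
  next
    case False
    have "walk_within ?G 7 (T 1) t"
      using T8 blade[OF t] by (cases "t = T 8") (auto elim: walk_within_mono)
    with False s show ?thesis
      using walk_within_trans[OF walk_within_sym[OF blade[of s]]] by fastforce
  qed
  then have "graph_dist ?G s t \<le> enat 13" if "s \<in> verts ?G" "t \<in> verts ?G" for s t
    using that by (intro graph_dist_le_if_walk_within) (auto simp: wp_graph_def)
  then show ?thesis
    unfolding diameter_def by (auto simp: numeral_eq_enat intro!: SUP_least)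
qed

lemma bit_iff_diameter_wp:
  assumes "\<pi> permutes {1..N}" and "\<psi> \<in> {1..N}"
  shows "bit (\<pi> \<psi>) (\<gamma> - 1) \<longleftrightarrow> 14 \<le> diameter (wp_graph N \<pi> \<psi> \<gamma>)"
proof -
  have "\<not> (14::enat) \<le> 13" by simp
  then show ?thesis
    using diameter_wp_ge[OF assms] diameter_wp_le[OF assms(1)] order_trans by metis
qed

section \<open>Splitting the stream\<close>

definition portals :: "nat \<Rightarrow> wp_vertex set" where
  "portals N = (\<lambda>i. U i 4) ` {1..N} \<union> (\<lambda>i. V i 4) ` {1..N}"

lemma portals_subset: "portals N \<subseteq> wp_verts N"
  by (auto simp: portals_def in_wp_verts)

text \<open>Edges whose form depends on \<psi> or \<gamma> join only vertices with second index at
  most 3 or \<open>T 1\<close>, hence no portals.\<close>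

lemma wp_edges_at_portal:
  assumes v: "v \<in> portals N"
  shows "{e \<in> wp_edges N \<pi> \<psi> \<gamma>. v \<in> e} = {e \<in> wp_edges N \<pi> \<psi>' \<gamma>'. v \<in> e}"
proof -
  have "e \<in> wp_edges N \<pi> \<psi>' \<gamma>'" if e: "e \<in> wp_edges N \<pi> \<psi> \<gamma>" "v \<in> e" for e \<psi> \<gamma> \<psi>' \<gamma>'
    using e(1)
  proof (cases rule: wp_edgesE)
    case (portal i)
    then show ?thesis by (rule wp_edgesI_portal)
  qed (use e(2) v in \<open>auto simp: portals_def split: if_splits\<close>)
  then show ?thesis by blast
qed

text \<open>The only edges that mention \<pi> are those from \<open>U i 4\<close> to
  \<open>V (\<pi> i) 4\<close>. Both ends are portals, because a permutation keeps
  \<open>\<pi> i\<close> in range.\<close>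

lemma wp_edges_at_non_portal:
  assumes \<pi>: "\<pi> permutes {1..N}" and \<pi>': "\<pi>' permutes {1..N}" and v: "v \<notin> portals N"
  shows "{e \<in> wp_edges N \<pi> \<psi> \<gamma>. v \<in> e} = {e \<in> wp_edges N \<pi>' \<psi> \<gamma>. v \<in> e}"
proof -
  have "e \<in> wp_edges N \<pi>' \<psi> \<gamma>"
    if \<pi>: "\<pi> permutes {1..N}" and e: "e \<in> wp_edges N \<pi> \<psi> \<gamma>" "v \<in> e" for e \<pi> \<pi>'
    using e(1)
  proof (cases rule: wp_edgesE)
    case (path j)
    then show ?thesis by (simp only: wp_edgesI_path)
  next
    case (upper i)
    then show ?thesis by (rule wp_edgesI_upper)
  next
    case (lower i)
    then show ?thesis by (rule wp_edgesI_lower)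
  next
    case (portal i)
    have "\<pi> i \<in> {1..N}" using permutes_in_image[OF \<pi>] portal(1) by blast
    then have "{U i 4, V (\<pi> i) 4} \<subseteq> portals N" using portal(1) by (simp add: portals_def)
    then have "e \<noteq> {U i 4, V (\<pi> i) 4}" using e(2) v by blast
    then have "e \<in> {{U i 3, U i 4}, {V i 4, V i 1}, {U i 4, V (\<pi>' i) 4}}"
      using portal(2) unfolding insert_iff empty_iff by argo
    with portal(1) show ?thesis by (rule wp_edgesI_portal)
  qed
  with \<pi> \<pi>' show ?thesis by blast
qed

text \<open>The edge list is chosen as a function of the edge set alone, so that equal neighbourhoods
  give equal stream items.\<close>

definition al_item_at :: "('a \<Rightarrow> 'b) \<Rightarrow> 'a set set \<Rightarrow> 'a \<Rightarrow> 'b al_item" where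
  "al_item_at f E v = (f v, SOME es. distinct es \<and> set es = (`) f ` {e \<in> E. v \<in> e})"

lemma al_stream_map_al_item_at:
  assumes "inj_on f (verts G)" "\<Union> (edges G) \<subseteq> verts G" "finite (verts G)"
    and vs: "distinct vs" "set vs = verts G"
  shows "al_stream (map_graph f G) (map (al_item_at f (edges G)) vs)"
proof -
  have "edges G \<subseteq> Pow (verts G)" using assms(2) by blast
  then have fin: "finite (edges G)" using assms(3) by (simp add: finite_subset)
  have key: "distinct es \<and> set es = {e \<in> edges (map_graph f G). w \<in> e}"
    if v: "v \<in> verts G" and vw: "al_item_at f (edges G) v = (w, es)" for v w es
  proof -
    have "\<exists>es. set es = (`) f ` {e \<in> edges G. v \<in> e} \<and> distinct es"
      using fin by (intro finite_distinct_list) simp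
    then have "\<exists>es. distinct es \<and> set es = (`) f ` {e \<in> edges G. v \<in> e}" by blast
    from someI_ex[OF this] have "distinct es \<and> set es = (`) f ` {e \<in> edges G. v \<in> e}"
      using vw by (simp add: al_item_at_def)
    \<comment> \<open>Injectivity preserves incidence, so the edges at \<open>f v\<close> are
      exactly the images of the edges at \<open>v\<close>.\<close>
    moreover have "f v \<in> f ` e \<longleftrightarrow> v \<in> e" if "e \<in> edges G" for e
      by (rule inj_on_image_mem_iff[OF assms(1) v]) (use assms(2) that in blast)
    then have "{e \<in> (`) f ` edges G. f v \<in> e} = (`) f ` {e \<in> edges G. v \<in> e}"
      by blast
    moreover have "w = f v" using vw by (simp add: al_item_at_def)
    ultimately show ?thesis by (simp add: map_graph_def)
  qed
  have fst: "map fst (map (al_item_at f (edges G)) vs) = map f vs"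
    by (simp add: al_item_at_def)
  show ?thesis
    unfolding al_stream_def fst
  proof (intro conjI ballI)
    show "distinct (map f vs)" using vs assms(1) by (simp add: distinct_map)
    show "set (map f vs) = verts (map_graph f G)" using vs by (simp add: map_graph_def)
  next
    fix x assume "x \<in> set (map (al_item_at f (edges G)) vs)"
    then obtain v where "v \<in> verts G" "al_item_at f (edges G) v = x" using vs by auto
    then show "case x of (w, es) \<Rightarrow>
        distinct es \<and> set es = {e \<in> edges (map_graph f G). w \<in> e}"
      using key by (cases x) simp
  qed
qed

lemma length_run_le_memory_used: "length (run A xs) \<le> memory_used A (xs @ ys)"
  unfolding memory_used_def
  by (rule Max_ge) (auto intro!: image_eqI[of _ _ "length xs"])

section \<open>Counting memory states\<close>

text \<open>Pigeonhole: fewer than \<open>2 ^ L\<close> bit strings are shorter than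
  \<open>L\<close>.\<close>

lemma ex_length_ge_if_inj_on:
  fixes M :: "'a \<Rightarrow> bool list"
  assumes "inj_on M S" and "2 ^ L \<le> card S"
  shows "\<exists>x\<in>S. L \<le> length (M x)"
proof (rule ccontr)
  assume "\<not> ?thesis"
  then have short: "length (M x) < L" if "x \<in> S" for x using that by force
  have "card {xs :: bool list. length xs < n} < 2 ^ n \<and> finite {xs :: bool list. length xs < n}" for n
  proof (induction n)
    case (Suc n)
    have "{xs :: bool list. length xs < Suc n} = {xs. length xs < n} \<union> {xs. length xs = n}"
      by auto
    moreover have "card {xs :: bool list. length xs = n} = 2 ^ n" "finite {xs :: bool list. length xs = n}"
      using card_lists_length_eq[of "UNIV :: bool set" n]
        finite_lists_length_eq[of "UNIV :: bool set" n] by auto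
    ultimately show ?case
      using Suc card_Un_le[of "{xs :: bool list. length xs < n}" "{xs. length xs = n}"] by simp
  qed simp
  then have "card (M ` S) < 2 ^ L"
    using short by (metis (mono_tags, lifting) card_mono image_subsetI le_less_trans mem_Collect_eq)
  with assms show False by (simp add: card_image)
qed

section \<open>Numerical estimates\<close>

lemma power_mult_fact_le: "n ^ k * fact n \<le> (fact (n + k) :: nat)"
proof (induction k)
  case (Suc k)
  have "n ^ Suc k * fact n = n * (n ^ k * fact n)" by simp
  also have "\<dots> \<le> (n + Suc k) * (n ^ k * fact n)" by (intro mult_right_mono) auto
  also have "\<dots> \<le> (n + Suc k) * fact (n + k)" by (rule mult_left_mono[OF Suc]) simp
  finally show ?case by simp
qed simp

text \<open>A crude form of Stirling's bound: the upper half of the factors of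
  \<open>fact (2 ^ k)\<close> are all at least \<open>2 ^ (k - 1)\<close>.\<close>

lemma fact_power2_ge:
  assumes "k \<ge> 1"
  shows "2 ^ (2 ^ (k - 1) * (k - 1)) \<le> (fact (2 ^ k) :: nat)"
proof -
  let ?m = "2 ^ (k - 1) :: nat"
  have "2 ^ (?m * (k - 1)) = ?m ^ ?m"
    by (simp add: mult.commute flip: power_mult)
  also have "\<dots> \<le> ?m ^ ?m * fact ?m" by simp
  also have "\<dots> \<le> fact (?m + ?m)" by (rule power_mult_fact_le)
  also have "?m + ?m = 2 ^ k" using assms by (cases k) auto
  finally show ?thesis .
qed

text \<open>The low \<open>k\<close> bits give the residue modulo \<open>2 ^ k\<close>, and
  \<open>{1..2 ^ k}\<close> represents each residue once, with \<open>2 ^ k\<close> standing for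
  0.\<close>

lemma eq_if_bits_eq:
  fixes x y :: nat
  assumes "x \<in> {1..2 ^ k}" "y \<in> {1..2 ^ k}" and "\<And>i. i < k \<Longrightarrow> bit x i = bit y i"
  shows "x = y"
proof -
  have "take_bit k x = take_bit k y"
    using assms(3) by (auto simp: bit_eq_iff bit_take_bit_iff)
  then have "x mod 2 ^ k = y mod 2 ^ k" by (simp add: take_bit_eq_mod)
  moreover have "z mod 2 ^ k = (if z = 2 ^ k then 0 else z)" if "z \<in> {1..2 ^ k}" for z :: nat
    using that by auto
  ultimately show ?thesis using assms(1,2) by (auto split: if_splits)
qed

text \<open>Origin of 1/80: \<open>n\<close> is at most
  \<open>15 * 2 ^ k = 30 * 2 ^ (k - 1)\<close>, its logarithm is at most \<open>k + 4\<close>, and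
  \<open>30 * (k + 4)\<close> is at most \<open>80 * (k - 1)\<close> exactly from
  \<open>k = 4\<close> on.\<close>

lemma mult_log_le:
  assumes "k \<ge> 4" and n: "n = 7 * 2 ^ k + 8"
  shows "1 / 80 * (real n * log 2 (real n)) \<le> real (2 ^ (k - 1) * (k - 1))"
proof -
  have "(1::nat) \<le> 2 ^ k" by simp
  then have n_le: "n \<le> 15 * 2 ^ k" unfolding n by linarith
  have "log 2 (real n) \<le> real (k + 4)"
  proof -
    have "n \<le> 2 ^ (k + 4)" using n_le by (simp add: power_add)
    then have "real n \<le> 2 ^ (k + 4)" by (metis of_nat_le_iff of_nat_numeral of_nat_power)
    moreover have "real n > 0" using n by linarith
    ultimately have "log 2 (real n) \<le> log 2 (2 ^ (k + 4))"
      by (subst log_le_cancel_iff) auto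
    then show ?thesis by (simp del: power_add)
  qed
  moreover have "real n \<le> 15 * 2 ^ k"
    using n_le by (metis of_nat_le_iff of_nat_mult of_nat_numeral of_nat_power)
  moreover have "0 \<le> log 2 (real n)"
  proof -
    have "n \<ge> 1" using n by linarith
    then show ?thesis by simp
  qed
  ultimately have "real n * log 2 (real n) \<le> (15 * 2 ^ k) * real (k + 4)"
    by (intro mult_mono) auto
  also have "\<dots> \<le> 80 * (2 ^ (k - 1) * real (k - 1))"
  proof -
    have "2 ^ k = 2 * (2 ^ (k - 1) :: real)" using assms(1) by (cases k) auto
    moreover have "30 * real (k + 4) \<le> 80 * real (k - 1)" using assms(1) by (simp add: of_nat_diff)
    ultimately show ?thesis by (simp add: mult_left_mono field_simps)
  qed
  finally show ?thesis by simp
qed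

text \<open>After the portals, the same remaining items can be fed to the states of two
  permutations, and the output then tells bit \<gamma> of the image of \<psi>. Equal states
  therefore force equal permutations. The arguments \<open>1 1\<close> are placeholders, as the
  portal items depend on neither \<psi> nor \<gamma>.\<close>

lemma state_determines_permutation:
  fixes A :: "nat \<Rightarrow> nat one_pass_alg"
  assumes F: "solves_diameter_on A F" and lab: "inj_on lab (wp_verts (2 ^ k))"
    and mem: "\<And>\<pi> \<psi> \<gamma>. \<pi> permutes {1..2 ^ k} \<Longrightarrow> \<psi> \<in> {1..2 ^ k} \<Longrightarrow> \<gamma> \<in> {1..k} \<Longrightarrow>
      map_graph lab (wp_graph (2 ^ k) \<pi> \<psi> \<gamma>) \<in> F"
    and ps: "distinct ps" "set ps = portals (2 ^ k)"
  shows "inj_on (\<lambda>\<pi>. run (A (7 * 2 ^ k + 8)) (map (al_item_at lab (wp_edges (2 ^ k) \<pi> 1 1)) ps))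
    {\<pi>. \<pi> permutes {1..2 ^ k}}"
proof (rule inj_onI)
  define N :: nat where "N = 2 ^ k"
  let ?A = "A (7 * N + 8)"
  let ?it = "\<lambda>\<pi> \<psi> \<gamma>. al_item_at lab (wp_edges N \<pi> \<psi> \<gamma>)"
  fix \<pi> \<pi>'
  assume "\<pi> \<in> {\<pi>. \<pi> permutes {1..2 ^ k}}" "\<pi>' \<in> {\<pi>. \<pi> permutes {1..2 ^ k}}"
    and "run (A (7 * 2 ^ k + 8)) (map (al_item_at lab (wp_edges (2 ^ k) \<pi> 1 1)) ps) =
      run (A (7 * 2 ^ k + 8)) (map (al_item_at lab (wp_edges (2 ^ k) \<pi>' 1 1)) ps)"
  then have \<pi>: "\<pi> permutes {1..N}" and \<pi>': "\<pi>' permutes {1..N}"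
    and eq: "run ?A (map (?it \<pi> 1 1) ps) = run ?A (map (?it \<pi>' 1 1) ps)"
    by (simp_all add: N_def)
  obtain qs where qs: "distinct qs" "set qs = wp_verts N - portals N"
    using finite_distinct_list finite_wp_verts by (metis finite_Diff)
  \<comment> \<open>The graph belongs to \<rho>, but the items for \<open>qs\<close> are those of
    the fixed \<pi>. Hence the right-hand side depends on \<rho> only through the state after
    \<open>ps\<close>, and it agrees for \<pi> and \<pi>'.\<close>
  have out: "diameter (wp_graph N \<rho> \<psi> \<gamma>) =
      out ?A (foldl (step ?A) (run ?A (map (?it \<rho> 1 1) ps)) (map (?it \<pi> \<psi> \<gamma>) qs))"
    if \<rho>: "\<rho> permutes {1..N}" and \<psi>: "\<psi> \<in> {1..N}" and \<gamma>: "\<gamma> \<in> {1..k}" for \<rho> \<psi> \<gamma>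
  proof -
    let ?G = "wp_graph N \<rho> \<psi> \<gamma>"
    have sub: "\<Union> (edges ?G) \<subseteq> verts ?G"
      using Union_wp_edges_subset[OF \<rho>] by (simp add: wp_graph_def)
    have inj: "inj_on lab (verts ?G)" using lab by (simp add: wp_graph_def N_def)
    have "al_stream (map_graph lab ?G) (map (al_item_at lab (edges ?G)) (ps @ qs))"
      using ps qs portals_subset[of N]
      by (intro al_stream_map_al_item_at inj sub)
        (auto simp: wp_graph_def finite_wp_verts N_def)
    moreover have "map_graph lab ?G \<in> F" using mem \<rho> \<psi> \<gamma> by (simp add: N_def)
    moreover have "card (verts (map_graph lab ?G)) = 7 * N + 8"
      using lab by (simp add: map_graph_def wp_graph_def card_image card_wp_verts N_def)
    ultimately have "out ?A (run ?A (map (?it \<rho> \<psi> \<gamma>) (ps @ qs))) = diameter (map_graph lab ?G)"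
      using F unfolding solves_diameter_on_def by (metis snd_conv wp_graph_def)
    moreover have "map (?it \<rho> \<psi> \<gamma>) ps = map (?it \<rho> 1 1) ps"
      using ps wp_edges_at_portal[of _ N \<rho> \<psi> \<gamma> 1 1] by (simp add: al_item_at_def N_def)
    moreover have "map (?it \<rho> \<psi> \<gamma>) qs = map (?it \<pi> \<psi> \<gamma>) qs"
      using qs wp_edges_at_non_portal[OF \<rho> \<pi>] by (simp add: al_item_at_def)
    ultimately show ?thesis
      by (simp add: diameter_map_graph[OF inj sub] run_def)
  qed
  show "\<pi> = \<pi>'"
  proof
    fix \<psi>
    show "\<pi> \<psi> = \<pi>' \<psi>"
    proof (cases "\<psi> \<in> {1..N}")
      case True
      \<comment> \<open>The index \<gamma> counts from 1, so bit \<open>i\<close> is queried with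
        \<gamma> equal to \<open>Suc i\<close>.\<close>
      have "bit (\<pi> \<psi>) i = bit (\<pi>' \<psi>) i" if "i < k" for i
        using bit_iff_diameter_wp[OF \<pi> True, of "Suc i"] bit_iff_diameter_wp[OF \<pi>' True, of "Suc i"]
          out[OF \<pi> True, of "Suc i"] out[OF \<pi>' True, of "Suc i"] eq that by simp
      then show ?thesis
        using True permutes_in_image[OF \<pi>, of \<psi>] permutes_in_image[OF \<pi>', of \<psi>]
        by (intro eq_if_bits_eq[of _ k]) (auto simp: N_def)
    next
      case False
      then show ?thesis using \<pi> \<pi>' by (simp add: permutes_not_in)
    qed
  qed
qed

theorem theorem28:
  "\<exists>c0::real. c0 > 0 \<and> (\<exists>n0::nat. \<forall>(F :: nat ugraph set) (A :: nat \<Rightarrow> nat one_pass_alg).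
     (\<forall>G\<in>F. simple_graph G) \<and> contains_all_wp F \<and> solves_diameter_on A F \<longrightarrow>
     (\<forall>n\<ge>n0. (\<exists>k. n = 7 * 2 ^ k + 8) \<longrightarrow>
        (\<exists>G\<in>F. card (verts G) = n \<and>
           (\<exists>xs. al_stream G xs \<and>
              real (memory_used (A n) xs) \<ge> c0 * (real n * log 2 (real n))))))"
proof -
  have main: "\<exists>G\<in>F. card (verts G) = n \<and>
      (\<exists>xs. al_stream G xs \<and> real (memory_used (A n) xs) \<ge> 1 / 80 * (real n * log 2 (real n)))"
    if F: "contains_all_wp F" "solves_diameter_on A F" and n: "n \<ge> 120" "n = 7 * 2 ^ k + 8"
    for F :: "nat ugraph set" and A :: "nat \<Rightarrow> nat one_pass_alg" and n k :: nat
  proof -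
    \<comment> \<open>The threshold 120 is \<open>7 * 2 ^ 4 + 8\<close>.\<close>
    have k: "k \<ge> 4"
    proof (rule ccontr)
      assume "\<not> k \<ge> 4"
      then have "(2::nat) ^ k \<le> 2 ^ 3" by (intro power_increasing) auto
      with n show False by simp
    qed
    define N :: nat where "N = 2 ^ k"
    obtain lab where lab: "inj_on lab (wp_verts N)"
      and mem: "\<And>\<pi> \<psi> \<gamma>. \<pi> permutes {1..N} \<Longrightarrow> \<psi> \<in> {1..N} \<Longrightarrow> \<gamma> \<in> {1..k} \<Longrightarrow>
        map_graph lab (wp_graph N \<pi> \<psi> \<gamma>) \<in> F"
      using F(1) unfolding contains_all_wp_def N_def by blast
    obtain ps where ps: "distinct ps" "set ps = portals N"
      using finite_distinct_list[of "portals N"] by (auto simp: portals_def)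
    obtain qs where qs: "distinct qs" "set qs = wp_verts N - portals N"
      using finite_distinct_list finite_wp_verts by (metis finite_Diff)
    have "2 ^ (2 ^ (k - 1) * (k - 1)) \<le> card {\<pi>. \<pi> permutes {1..N}}"
      using fact_power2_ge[of k] k by (simp add: card_permutations N_def)
    with state_determines_permutation[OF F(2) lab[unfolded N_def] mem[unfolded N_def]
        ps[unfolded N_def]]
    obtain \<pi> where \<pi>: "\<pi> permutes {1..N}"
      and long: "2 ^ (k - 1) * (k - 1) \<le> length (run (A n) (map (al_item_at lab (wp_edges N \<pi> 1 1)) ps))"
      using ex_length_ge_if_inj_on unfolding n(2) N_def by (metis (no_types, lifting) mem_Collect_eq)
    \<comment> \<open>The long state occurs right after the portals, before \<psi> and \<gamma>
      matter, so any admissible pair completes the input; \<open>\<gamma> = 1\<close> is admissible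
      because \<open>k\<close> is positive.\<close>
    let ?G = "wp_graph N \<pi> 1 1"
    let ?xs = "map (al_item_at lab (edges ?G)) (ps @ qs)"
    have "al_stream (map_graph lab ?G) ?xs"
      using ps qs portals_subset[of N] lab Union_wp_edges_subset[OF \<pi>]
      by (intro al_stream_map_al_item_at) (auto simp: wp_graph_def finite_wp_verts)
    moreover have "map_graph lab ?G \<in> F" using mem[OF \<pi>] k by (simp add: N_def)
    moreover have "card (verts (map_graph lab ?G)) = n"
      using lab n by (simp add: map_graph_def wp_graph_def card_image card_wp_verts N_def)
    moreover have "2 ^ (k - 1) * (k - 1) \<le> memory_used (A n) ?xs"
      using long length_run_le_memory_used order_trans by (fastforce simp: wp_graph_def)
    then have "1 / 80 * (real n * log 2 (real n)) \<le> real (memory_used (A n) ?xs)"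
      using mult_log_le[OF k n(2)] by (meson of_nat_le_iff order_trans)
    ultimately show ?thesis by blast
  qed
  show ?thesis
    by (rule exI[of _ "1 / 80"], rule conjI, simp, rule exI[of _ 120]) (use main in blast)
qed

end
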